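(* There exist positive constants $c, C$ such that for every integer $n>3$, \[ c\log_2 n\le \chi\big(J_\pm(n,3,-1)\big)\le C\log_2 n, \] where $J_\pm(n,3,-1)$ is the graph whose vertex set consists of all vectors $v\in\{-1,0,1\}^n$ with exactly $3$ nonzero coordinates, two vertices being adjacent if and only if their standard scalar product equals $-1$.
   Context: $\chi(G)$ denotes the chromatic number of $G$: the minimum number of colors in a coloring of the vertices such that adjacent vertices receive different colors. *)

theory Defs
  imports
    Complex_Main
    "Graph_Theory.Pair_Digraph"
    "Jordan_Normal_Form.Matrix"
begin

text \<open>
  Undirected simple graphs are finite loop-free symmetric digraphs without parallel
  arcs (locale \<^locale>\<open>pair_graph\<close>): an edge is represented by both of its arcs.
\<close>

definition proper_coloring :: "'a pair_pre_digraph \<Rightarrow> ('a \<Rightarrow> 'c) \<Rightarrow> bool" where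
  "proper_coloring G f \<longleftrightarrow> (\<forall>(u, v) \<in> parcs G. f u \<noteq> f v)"

text \<open>
  \<open>LEAST\<close> is meaningful only if some finite proper coloring exists, which lemma
  \<open>ex_proper_coloring\<close> guarantees for every finite loop-free graph.
\<close>

definition chromatic_number :: "'a pair_pre_digraph \<Rightarrow> nat" where
  "chromatic_number G =
    (LEAST k. \<exists>f :: 'a \<Rightarrow> nat. proper_coloring G f \<and> f ` pverts G \<subseteq> {..<k})"

text \<open>
  The condition \<open>u \<noteq> v\<close> only matters when \<open>t = int k\<close>, as \<open>u \<bullet> u = int k\<close> for every
  vertex \<open>u\<close>.
\<close>

definition J_pm :: "nat \<Rightarrow> nat \<Rightarrow> int \<Rightarrow> int vec pair_pre_digraph" where
  "J_pm n k t =
    (let V = {v \<in> carrier_vec n. (\<forall>i<n. v $ i \<in> {-1, 0, 1}) \<and> card {i. i < n \<and> v $ i \<noteq> 0} = k}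
     in \<lparr>pverts = V, parcs = {(u, v). u \<in> V \<and> v \<in> V \<and> u \<noteq> v \<and> u \<bullet> v = t}\<rparr>)"

lemma ex_proper_coloring:
  assumes "pair_fin_digraph G" and "pair_loopfree_digraph G"
  shows "\<exists>k. \<exists>f :: 'a \<Rightarrow> nat. proper_coloring G f \<and> f ` pverts G \<subseteq> {..<k}"
proof -
  interpret pair_fin_digraph G by fact
  interpret L: pair_loopfree_digraph G by fact
  obtain f :: "'a \<Rightarrow> nat" where f: "bij_betw f (pverts G) {0..<card (pverts G)}"
    using ex_bij_betw_finite_nat[OF pair_finite_verts] by blast
  have "f u \<noteq> f v" if "(u, v) \<in> parcs G" for u v
    using that f in_arcsD1[OF that] in_arcsD2[OF that] L.no_loops'[of u v]
    by (auto simp: bij_betw_def inj_on_def)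
  moreover have "f ` pverts G \<subseteq> {..<card (pverts G)}"
    using f by (auto simp: bij_betw_def)
  ultimately show ?thesis
    unfolding proper_coloring_def by blast
qed

lemma finite_verts_J_pm: "finite (pverts (J_pm n k t))"
proof -
  have "pverts (J_pm n k t) \<subseteq> vec_of_list ` {xs. set xs \<subseteq> {-1, 0, 1} \<and> length xs = n}"
  proof
    fix v assume v: "v \<in> pverts (J_pm n k t)"
    then have "dim_vec v = n" and "\<forall>i<n. v $ i \<in> {-1, 0, 1}"
      by (auto simp: J_pm_def Let_def)
    then have "set (list_of_vec v) \<subseteq> {-1, 0, 1}" and "length (list_of_vec v) = n"
      by (auto simp: in_set_conv_nth list_of_vec_index)
    moreover have "v = vec_of_list (list_of_vec v)" by (simp add: vec_list)
    ultimately show "v \<in> vec_of_list ` {xs. set xs \<subseteq> {-1, 0, 1} \<and> length xs = n}"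
      by blast
  qed
  then show ?thesis
    by (rule finite_subset) (simp add: finite_lists_length_eq)
qed

lemma pair_graph_J_pm: "pair_graph (J_pm n k t)"
proof
  show fv: "finite (pverts (J_pm n k t))" by (rule finite_verts_J_pm)
  have sub: "parcs (J_pm n k t) \<subseteq> pverts (J_pm n k t) \<times> pverts (J_pm n k t)"
    by (auto simp: J_pm_def Let_def)
  show "finite (parcs (J_pm n k t))"
    using sub fv by (meson finite_SigmaI finite_subset)
  show "fst e \<in> pverts (J_pm n k t)" "snd e \<in> pverts (J_pm n k t)"
    if "e \<in> parcs (J_pm n k t)" for e
    using that sub by auto
  show "fst e \<noteq> snd e" if "e \<in> parcs (J_pm n k t)" for e
    using that by (auto simp: J_pm_def Let_def)
  have "sym (parcs (J_pm n k t))"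
    by (auto simp: sym_def J_pm_def Let_def comm_scalar_prod[of _ n])
  then show "symmetric (with_proj (J_pm n k t))"
    by (simp add: symmetric_def arcs_ends_def arc_to_ends_def)
qed

end

theory Submission
  imports Defs
begin

text \<open>
  Lower bound: for \<open>i < j < m\<close> with \<open>2 m \<le> n\<close>, the vectors \<open>e\<^sub>i - e\<^sub>j + e\<^bsub>m+j\<^esub>\<close> span a copy of the
  shift graph on the pairs from \<open>{..<m}\<close>, and a proper coloring of that graph gives pairwise
  distinct sets of colors \<open>{f (i, j) | j > i}\<close>, so \<open>m \<le> 2\<^sup>\<chi>\<close>.

  Upper bound: vertices whose signs all agree with one common sign function on \<open>{..<n}\<close> have
  nonnegative scalar products, hence form an independent set. A uniformly random sign function
  agrees with a given vertex with probability \<open>1/8\<close>, so greedily chosen sign functions exhaust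
  all \<open>O(n\<^sup>3)\<close> vertices after \<open>O(log n)\<close> steps.
\<close>

section \<open>Chromatic number\<close>

lemma chromatic_number_le:
  fixes f :: "'a \<Rightarrow> nat"
  assumes "proper_coloring G f" and "f ` pverts G \<subseteq> {..<k}"
  shows "chromatic_number G \<le> k"
  unfolding chromatic_number_def by (rule Least_le) (use assms in blast)

lemma chromatic_number_coloring:
  assumes "pair_graph G"
  obtains f :: "'a \<Rightarrow> nat"
  where "proper_coloring G f" and "f ` pverts G \<subseteq> {..<chromatic_number G}"
proof -
  interpret pair_graph G by fact
  have "\<exists>k. \<exists>f :: 'a \<Rightarrow> nat. proper_coloring G f \<and> f ` pverts G \<subseteq> {..<k}"
    by (rule ex_proper_coloring) unfold_locales
  then have "\<exists>f :: 'a \<Rightarrow> nat. proper_coloring G f \<and> f ` pverts G \<subseteq> {..<chromatic_number G}"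
    unfolding chromatic_number_def by (rule LeastI_ex)
  then show thesis using that by blast
qed

section \<open>Lower bound\<close>

text \<open>Let \<open>A i\<close> be the set of colors on pairs starting at \<open>i\<close>. For
  \<open>i < j\<close> the color \<open>f i j\<close> lies in \<open>A i\<close>; in
  \<open>A j\<close> it would equal some \<open>f j l\<close>, against \<open>proper\<close>. So
  \<open>A\<close> maps the \<open>m\<close> indices injectively to subsets of
  \<open>{..<k}\<close>.\<close>

lemma shift_coloring_bound:
  fixes f :: "nat \<Rightarrow> nat \<Rightarrow> nat"
  assumes less: "\<And>i j. i < j \<Longrightarrow> j < m \<Longrightarrow> f i j < k"
    and proper: "\<And>i j l. i < j \<Longrightarrow> j < l \<Longrightarrow> l < m \<Longrightarrow> f i j \<noteq> f j l"
  shows "m \<le> 2 ^ k"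
proof -
  define A where "A i = f i ` {i<..<m}" for i
  have neq: "A i \<noteq> A j" if "i < j" "j < m" for i j
  proof -
    have "f i j \<in> A i" using that by (auto simp: A_def)
    moreover have "f i j \<notin> A j"
    proof
      assume "f i j \<in> A j"
      then obtain l where "j < l" "l < m" "f i j = f j l" unfolding A_def by auto
      then show False using proper[OF \<open>i < j\<close>] by blast
    qed
    ultimately show ?thesis by blast
  qed
  have "inj_on A {..<m}"
  proof (rule inj_onI)
    fix i j assume "i \<in> {..<m}" "j \<in> {..<m}" "A i = A j"
    then show "i = j" using neq[of i j] neq[of j i] by (metis lessThan_iff linorder_neq_iff)
  qed
  moreover have "A ` {..<m} \<subseteq> Pow {..<k}"
    unfolding A_def by (auto intro: less)
  ultimately have "card {..<m} \<le> card (Pow {..<k})"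
    by (intro card_inj_on_le[of A]) auto
  then show ?thesis by (simp add: card_Pow)
qed

text \<open>The entry at \<open>m + j\<close> is padding: it raises the support to size 3 and, lying
  beyond all indices below \<open>m\<close>, contributes nothing to the scalar products
  needed.\<close>

definition shift_vec :: "nat \<Rightarrow> nat \<Rightarrow> nat \<Rightarrow> nat \<Rightarrow> int vec" where
  "shift_vec n m i j =
    vec n (\<lambda>x. if x = i then 1 else if x = j then -1 else if x = m + j then 1 else 0)"

lemma shift_vec_in_verts:
  assumes "i < j" "j < m" "2 * m \<le> n"
  shows "shift_vec n m i j \<in> pverts (J_pm n 3 t)"
proof -
  have "{x. x < n \<and> shift_vec n m i j $ x \<noteq> 0} = {i, j, m + j}"
    using assms by (auto simp: shift_vec_def split: if_splits)
  moreover have "card {i, j, m + j} = 3" using assms by simp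
  ultimately show ?thesis
    by (simp add: J_pm_def Let_def) (simp add: shift_vec_def)
qed

text \<open>The supports \<open>{i, j, m + j}\<close> and \<open>{j, l, m + l}\<close> meet only in
  \<open>j\<close>, where the entries are -1 and 1.\<close>

lemma shift_vec_scalar_prod:
  assumes "i < j" "j < l" "l < m" "2 * m \<le> n"
  shows "shift_vec n m i j \<bullet> shift_vec n m j l = -1"
proof -
  have "shift_vec n m i j \<bullet> shift_vec n m j l = (\<Sum>x\<in>{0..<n}. if x = j then -1 else 0)"
    unfolding scalar_prod_def
    by (rule sum.cong) (use assms in \<open>auto simp: shift_vec_def\<close>)
  also have "\<dots> = -1" using assms by simp
  finally show ?thesis .
qed

lemma le_two_power_chromatic_number_J_pm:
  assumes "2 * m \<le> n"
  shows "m \<le> 2 ^ chromatic_number (J_pm n 3 (-1))"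
proof -
  obtain f where f: "proper_coloring (J_pm n 3 (-1)) f"
    and k: "f ` pverts (J_pm n 3 (-1)) \<subseteq> {..<chromatic_number (J_pm n 3 (-1))}"
    using chromatic_number_coloring[OF pair_graph_J_pm] .
  show ?thesis
  proof (rule shift_coloring_bound[of m "\<lambda>i j. f (shift_vec n m i j)"])
    fix i j assume "i < j" "j < m"
    then show "f (shift_vec n m i j) < chromatic_number (J_pm n 3 (-1))"
      using shift_vec_in_verts[OF _ _ assms] k by blast
  next
    fix i j l assume ijl: "i < j" "j < l" "l < m"
    \<comment> \<open>Arcs of \<open>J_pm\<close> join distinct vertices only; coordinate
      \<open>i\<close> separates these two, with entries 1 and 0.\<close>
    have "shift_vec n m i j $ i \<noteq> shift_vec n m j l $ i"
      using ijl assms by (simp add: shift_vec_def)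
    then have "shift_vec n m i j \<noteq> shift_vec n m j l" by metis
    moreover have "shift_vec n m i j \<in> pverts (J_pm n 3 (-1))"
      "shift_vec n m j l \<in> pverts (J_pm n 3 (-1))"
      using shift_vec_in_verts ijl assms by auto
    ultimately have "(shift_vec n m i j, shift_vec n m j l) \<in> parcs (J_pm n 3 (-1))"
      using shift_vec_scalar_prod[OF ijl assms] by (simp add: J_pm_def Let_def)
    then show "f (shift_vec n m i j) \<noteq> f (shift_vec n m j l)"
      using f by (auto simp: proper_coloring_def)
  qed
qed

section \<open>Upper bound\<close>

lemma card_subsets_with_trace:
  assumes "finite X" "A \<subseteq> X" "B \<subseteq> A"
  shows "card {H \<in> Pow X. H \<inter> A = B} = 2 ^ (card X - card A)"
proof -
  \<comment> \<open>A set with trace \<open>B\<close> on \<open>A\<close> is \<open>B\<close>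
    together with an arbitrary part outside \<open>A\<close>.\<close>
  have "bij_betw (\<lambda>K. K \<union> B) (Pow (X - A)) {H \<in> Pow X. H \<inter> A = B}"
    by (rule bij_betwI[where g = "\<lambda>H. H - A"]) (use assms in auto)
  then have "card {H \<in> Pow X. H \<inter> A = B} = card (Pow (X - A))"
    by (simp add: bij_betw_same_card)
  also have "\<dots> = 2 ^ (card X - card A)"
    using assms by (simp add: card_Pow card_Diff_subset finite_subset)
  finally show ?thesis .
qed

text \<open>Averaging over all subsets of \<open>X\<close>.\<close>

lemma ex_trace_popular:
  fixes S :: "('a set \<times> 'a set) set"
  assumes X: "finite X" and fin: "finite S"
    and S: "\<And>A B. (A, B) \<in> S \<Longrightarrow> A \<subseteq> X \<and> card A = k \<and> B \<subseteq> A"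
  obtains H where "card S \<le> 2 ^ k * card {(A, B) \<in> S. H \<inter> A = B}"
proof (rule ccontr)
  assume "\<not> thesis"
  then have less: "2 ^ k * card {(A, B) \<in> S. H \<inter> A = B} < card S" for H
    using that not_less by blast
  then have "S \<noteq> {}" by force
  \<comment> \<open>This makes the natural-number subtraction in \<open>2 ^ (card X - k)\<close>
    exact, so that multiplying by \<open>2 ^ k\<close> yields \<open>2 ^ card X\<close>.\<close>
  then have k: "k \<le> card X" using S X by (metis card_mono ex_in_conv surj_pair)
  have "(\<Sum>H\<in>Pow X. card {(A, B) \<in> S. H \<inter> A = B})
      = (\<Sum>H\<in>Pow X. \<Sum>(A, B)\<in>S. if H \<inter> A = B then 1 else 0)"
    using fin by (intro sum.cong refl) (simp add: sum.If_cases split_def Int_def)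
  also have "\<dots> = (\<Sum>(A, B)\<in>S. \<Sum>H\<in>Pow X. if H \<inter> A = B then 1 else 0)"
    by (subst sum.swap) (simp add: split_def)
  also have "\<dots> = (\<Sum>(A, B)\<in>S. card {H \<in> Pow X. H \<inter> A = B})"
    using X by (simp add: sum.If_cases Int_def)
  also have "\<dots> = (\<Sum>(A, B)\<in>S. 2 ^ (card X - k))"
    by (intro sum.cong refl) (use S card_subsets_with_trace[OF X] in auto)
  finally have "2 ^ k * (\<Sum>H\<in>Pow X. card {(A, B) \<in> S. H \<inter> A = B}) = card S * 2 ^ card X"
    using k by (simp add: split_def flip: power_add)
  moreover have "(\<Sum>H\<in>Pow X. 2 ^ k * card {(A, B) \<in> S. H \<inter> A = B}) < (\<Sum>H\<in>Pow X. card S)"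
    using X less by (intro sum_strict_mono) auto
  ultimately show False
    using X by (simp add: card_Pow flip: sum_distrib_left)
qed

text \<open>Greedy choice: a popular \<open>H\<close> settles at least a fraction
  \<open>1 / 2 ^ k\<close> of the pairs, and the induction hypothesis handles the rest. For
  \<open>N = 0\<close> the bound forces \<open>S\<close> to be empty.\<close>

lemma ex_trace_cover:
  fixes S :: "('a set \<times> 'a set) set"
  assumes X: "finite X" and "finite S"
    and "\<And>A B. (A, B) \<in> S \<Longrightarrow> A \<subseteq> X \<and> card A = k \<and> B \<subseteq> A"
    and "real (card S) * (1 - 1 / 2 ^ k) ^ N < 1"
  shows "\<exists>h :: nat \<Rightarrow> 'a set. \<forall>(A, B)\<in>S. \<exists>i<N. h i \<inter> A = B"
  using assms(2-)
proof (induction N arbitrary: S)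
  case 0
  then show ?case by simp
next
  case (Suc N)
  obtain H where H: "card S \<le> 2 ^ k * card {(A, B) \<in> S. H \<inter> A = B}"
    using ex_trace_popular[OF X Suc.prems(1,2)] by blast
  define T where "T = {(A, B) \<in> S. H \<inter> A = B}"
  have T: "T \<subseteq> S" "finite T" using Suc.prems(1) by (auto simp: T_def intro: finite_subset)
  have "real (card S) \<le> 2 ^ k * real (card T)"
    using H[folded T_def] by (metis of_nat_le_iff of_nat_mult of_nat_numeral of_nat_power)
  then have "real (card S) / 2 ^ k \<le> real (card T)" by (simp add: field_simps)
  moreover have "real (card (S - T)) = real (card S) - real (card T)"
    using T Suc.prems(1) by (simp add: card_Diff_subset of_nat_diff card_mono)
  ultimately have "real (card (S - T)) \<le> real (card S) * (1 - 1 / 2 ^ k)"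
    by (simp add: algebra_simps)
  then have "real (card (S - T)) * (1 - 1 / 2 ^ k) ^ N
      \<le> real (card S) * (1 - 1 / 2 ^ k) * (1 - 1 / 2 ^ k) ^ N"
    by (rule mult_right_mono) simp
  also have "\<dots> < 1" using Suc.prems(3) by (simp add: mult.assoc)
  finally have "\<exists>h :: nat \<Rightarrow> 'a set. \<forall>(A, B)\<in>S - T. \<exists>i<N. h i \<inter> A = B"
  proof (rule Suc.IH[rotated 2])
    show "finite (S - T)" using Suc.prems(1) by simp
    show "A \<subseteq> X \<and> card A = k \<and> B \<subseteq> A" if "(A, B) \<in> S - T" for A B
      using that Suc.prems(2)[of A B] by simp
  qed
  then obtain h :: "nat \<Rightarrow> 'a set" where h: "\<forall>(A, B)\<in>S - T. \<exists>i<N. h i \<inter> A = B" ..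
  have "\<exists>i<Suc N. (h(N := H)) i \<inter> A = B" if "(A, B) \<in> S" for A B
  proof (cases "(A, B) \<in> T")
    case True
    then have "H \<inter> A = B" by (simp add: T_def)
    then show ?thesis by (intro exI[of _ N]) simp
  next
    case False
    with that obtain i where "i < N" "h i \<inter> A = B"
      using bspec[OF h, of "(A, B)"] by auto
    then show ?thesis by (intro exI[of _ i]) simp
  qed
  then show ?case by (intro exI[of _ "h(N := H)"]) (simp add: split_def)
qed

section \<open>Coloring by common sign functions\<close>

lemma scalar_prod_nonneg_if_common_signs:
  fixes u v :: "int vec"
  assumes dim: "dim_vec v = n"
    and u: "\<And>i. i < n \<Longrightarrow> u $ i \<in> {-1, 0, 1}" "H \<inter> {i. i < n \<and> u $ i \<noteq> 0} = {i. i < n \<and> u $ i = 1}"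
    and v: "\<And>i. i < n \<Longrightarrow> v $ i \<in> {-1, 0, 1}" "H \<inter> {i. i < n \<and> v $ i \<noteq> 0} = {i. i < n \<and> v $ i = 1}"
  shows "0 \<le> u \<bullet> v"
  unfolding scalar_prod_def
proof (rule sum_nonneg)
  fix i assume "i \<in> {0..<dim_vec v}"
  then have i: "i < n" using dim by simp
  \<comment> \<open>\<open>H\<close> encodes a sign function, positive exactly on \<open>H\<close>.
    Where both entries are nonzero they carry the sign it prescribes, so their product is 1.\<close>
  have "i \<in> H \<longleftrightarrow> u $ i = 1" if "u $ i \<noteq> 0"
    using eqset_imp_iff[OF u(2), of i] i that by simp
  moreover have "i \<in> H \<longleftrightarrow> v $ i = 1" if "v $ i \<noteq> 0"
    using eqset_imp_iff[OF v(2), of i] i that by simp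
  ultimately show "0 \<le> u $ i * v $ i"
    using u(1)[OF i] v(1)[OF i] by auto
qed

text \<open>A vertex is recorded as the pair of its support and its set of positive coordinates;
  there are \<open>(n choose k) * 2 ^ k\<close> candidate pairs. Its color is the index of a
  covering set with the right trace. Vertices of one color have nonnegative scalar product, hence
  are not adjacent as \<open>t < 0\<close>.\<close>

lemma chromatic_number_J_pm_le:
  assumes N: "real (n choose k) * 2 ^ k * (1 - 1 / 2 ^ k) ^ N < 1" and "t < 0"
  shows "chromatic_number (J_pm n k t) \<le> N"
proof -
  let ?S = "SIGMA A:{A. A \<subseteq> {..<n} \<and> card A = k}. Pow A"
  let ?supp = "\<lambda>v :: int vec. {i. i < n \<and> v $ i \<noteq> 0}"
  let ?pos = "\<lambda>v :: int vec. {i. i < n \<and> v $ i = 1}"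
  have finA: "finite A" if "A \<subseteq> {..<n}" for A
    using that by (rule finite_subset) simp
  have "card ?S = (\<Sum>A | A \<subseteq> {..<n} \<and> card A = k. card (Pow A))"
    using finA by (intro card_SigmaI) auto
  also have "\<dots> = (n choose k) * 2 ^ k"
    using finA by (simp add: card_Pow n_subsets)
  finally have card: "real (card ?S) * (1 - 1 / 2 ^ k) ^ N < 1"
    using N by simp
  have fin: "finite ?S"
    using finA by (intro finite_SigmaI) auto
  have "\<exists>h :: nat \<Rightarrow> nat set. \<forall>(A, B)\<in>?S. \<exists>i<N. h i \<inter> A = B"
    by (rule ex_trace_cover[OF finite_lessThan[of n] fin _ card]) auto
  then obtain h :: "nat \<Rightarrow> nat set" where h: "\<forall>(A, B)\<in>?S. \<exists>i<N. h i \<inter> A = B" ..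
  define f where "f v = (SOME i. i < N \<and> h i \<inter> ?supp v = ?pos v)" for v
  have f: "f v < N \<and> h (f v) \<inter> ?supp v = ?pos v" if "v \<in> pverts (J_pm n k t)" for v
  proof -
    have "(?supp v, ?pos v) \<in> ?S" using that by (auto simp: J_pm_def Let_def)
    then have "\<exists>i<N. h i \<inter> ?supp v = ?pos v" using bspec[OF h] by fastforce
    then show ?thesis unfolding f_def by (rule someI_ex)
  qed
  have "f u \<noteq> f v" if "(u, v) \<in> parcs (J_pm n k t)" for u v
  proof
    assume eq: "f u = f v"
    have uv: "u \<in> pverts (J_pm n k t)" "v \<in> pverts (J_pm n k t)" and t: "u \<bullet> v = t"
      using that by (auto simp: J_pm_def Let_def)
    have entry: "w $ i \<in> {-1, 0, 1}" if "w \<in> pverts (J_pm n k t)" "i < n" for w i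
      using that by (simp add: J_pm_def Let_def)
    have "dim_vec v = n" using uv(2) by (simp add: J_pm_def Let_def)
    moreover have "h (f v) \<inter> ?supp u = ?pos u" using f[OF uv(1)] eq by metis
    moreover have "h (f v) \<inter> ?supp v = ?pos v" using f[OF uv(2)] by blast
    ultimately have "0 \<le> u \<bullet> v"
      by (intro scalar_prod_nonneg_if_common_signs[of v n u "h (f v)"] entry uv)
    then show False using t \<open>t < 0\<close> by simp
  qed
  then have "proper_coloring (J_pm n k t) f" by (auto simp: proper_coloring_def)
  then show ?thesis using f by (intro chromatic_number_le) auto
qed

section \<open>Logarithmic bounds with explicit constants\<close>

lemma chromatic_number_J_pm_le_log2:
  assumes "n > 3"
  shows "real (chromatic_number (J_pm n 3 (-1))) \<le> 60 * log 2 (real n)"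
proof -
  define L where "L = nat \<lceil>log 2 (real n)\<rceil>"
  have log2: "2 \<le> log 2 (real n)"
    using assms by (simp add: le_log_iff)
  then have L: "log 2 (real n) \<le> real L" "real L \<le> log 2 (real n) + 1"
    unfolding L_def by linarith+
  have nL: "real n \<le> 2 ^ L"
    using L(1) assms by (simp add: log_le_iff powr_realpow)
  \<comment> \<open>The factor \<open>2 ^ 3\<close> is absorbed by \<open>n ^ 2\<close>, which is at
    least 16; this leaves a pure power of \<open>n\<close>.\<close>
  have "real (n choose 3) * 2 ^ 3 \<le> real n ^ 3 * real n ^ 2"
  proof (rule mult_mono)
    have "n choose 3 \<le> n ^ 3" using assms by (intro binomial_le_pow) simp
    then show "real (n choose 3) \<le> real n ^ 3" by (metis of_nat_le_iff of_nat_power)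
    have "(4::real) ^ 2 \<le> real n ^ 2" using assms by (intro power_mono) auto
    then show "2 ^ 3 \<le> real n ^ 2" by simp
  qed auto
  also have "\<dots> = real n ^ 5" by (simp flip: power_add)
  also have "\<dots> \<le> (2 ^ L) ^ 5" using nL by (intro power_mono) auto
  also have "\<dots> = (2 ^ (5 * L) :: real)" by (simp add: mult.commute flip: power_mult)
  finally have "real (n choose 3) * 2 ^ 3 * (1 - 1 / 2 ^ 3) ^ (30 * L)
      \<le> 2 ^ (5 * L) * (1 - 1 / 2 ^ 3) ^ (30 * L)"
    by (rule mult_right_mono) simp
  \<comment> \<open>The 30 is 5 * 6: the 5 comes from \<open>n ^ 5\<close>, and 6 is the least
    exponent with \<open>2 * (7 / 8) ^ 6 < 1\<close>. Strictness of the next step also needs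
    \<open>L > 0\<close>.\<close>
  also have "\<dots> = (2 * (7 / 8) ^ 6) ^ (5 * L)"
    by (simp add: power_mult_distrib flip: power_mult)
  also have "\<dots> < 1"
    using L(1) log2 by (intro power_less_one_iff[THEN iffD2]) (auto simp: power_divide)
  finally have "chromatic_number (J_pm n 3 (-1)) \<le> 30 * L"
    by (rule chromatic_number_J_pm_le) simp
  then have "real (chromatic_number (J_pm n 3 (-1))) \<le> 30 * real L" by linarith
  then show ?thesis using L(2) log2 by linarith
qed

lemma log2_le_three_chromatic_number_J_pm:
  assumes "n > 3"
  shows "log 2 (real n) \<le> 3 * real (chromatic_number (J_pm n 3 (-1)))"
proof -
  define m where "m = n div 2"
  let ?k = "chromatic_number (J_pm n 3 (-1))"
  have m: "m \<ge> 2" "n \<le> 2 * m + 1" "2 * m \<le> n" using assms by (auto simp: m_def)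
  \<comment> \<open>Since \<open>m \<ge> 2\<close>, the factor 4 is at most \<open>m * m\<close>.
    Bounding \<open>n\<close> by \<open>m ^ 3\<close> avoids an additive constant in the logarithm
    and produces the factor 3.\<close>
  have "n \<le> 2 * 2 * m" using m by linarith
  also have "\<dots> \<le> m * m * m" using m(1) by (intro mult_right_mono mult_mono) auto
  also have "\<dots> = m ^ 3" by (simp add: power3_eq_cube)
  also have "\<dots> \<le> (2 ^ ?k) ^ 3"
    using le_two_power_chromatic_number_J_pm[OF m(3)] by (rule power_mono) simp
  also have "\<dots> = 2 ^ (3 * ?k)" by (simp add: mult.commute flip: power_mult)
  finally have "real n \<le> real (2 ^ (3 * ?k))" by (rule of_nat_mono)
  then have "log 2 (real n) \<le> log 2 (2 ^ (3 * ?k))"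
    using assms by (intro log_mono) auto
  then show ?thesis by (simp add: log_nat_power)
qed

theorem theorem2:
  shows "\<exists>c C :: real. c > 0 \<and> C > 0 \<and>
    (\<forall>n :: nat. n > 3 \<longrightarrow>
      c * log 2 (real n) \<le> real (chromatic_number (J_pm n 3 (-1))) \<and>
      real (chromatic_number (J_pm n 3 (-1))) \<le> C * log 2 (real n))"
proof (rule exI[of _ "1/3"], rule exI[of _ 60], intro conjI allI impI)
  fix n :: nat assume "n > 3"
  then show "1 / 3 * log 2 (real n) \<le> real (chromatic_number (J_pm n 3 (-1)))"
    using log2_le_three_chromatic_number_J_pm[of n] by simp
  show "real (chromatic_number (J_pm n 3 (-1))) \<le> 60 * log 2 (real n)"
    using \<open>n > 3\<close> by (rule chromatic_number_J_pm_le_log2)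
qed simp_all

end
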